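(* There are uncountably many pairwise non-equivalent $T_2$ compactifications of the real line $\mathbb{R}$ (with its usual topology); that is, the collection of equivalence classes of $T_2$ compactifications of $\mathbb{R}$ is uncountable.
   Context: A $T_2$ (Hausdorff) compactification of a topological space $X$ is a pair $\langle l, \delta X\rangle$ where $\delta X$ is a compact Hausdorff space and $l : X \to \delta X$ is a homeomorphism onto its image $l(X)$ (with the subspace topology) such that $l(X)$ is dense in $\delta X$. For two $T_2$ compactifications of $X$, write $\langle l_1, \delta_1 X\rangle \le \langle l_2, \delta_2 X\rangle$ if there is a continuous function $L : \delta_2 X \to \delta_1 X$ with $L\circ l_2 = l_1$. Two compactifications are equivalent if each is $\le$ the other. *)

theory Defs
  imports "HOL-Analysis.Analysis"
begin

definition T2_compactification :: "'x topology \<Rightarrow> ('x \<Rightarrow> 'a) \<times> 'a topology \<Rightarrow> bool" where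
  "T2_compactification X = (\<lambda>(l, \<delta>).
     compact_space \<delta> \<and> Hausdorff_space \<delta> \<and> embedding_map X \<delta> l \<and>
     \<delta> closure_of (l ` topspace X) = topspace \<delta>)"

(* The two compactifications may have their points in different types. *)
definition compactification_le ::
  "'x topology \<Rightarrow> ('x \<Rightarrow> 'a) \<times> 'a topology \<Rightarrow> ('x \<Rightarrow> 'b) \<times> 'b topology \<Rightarrow> bool" where
  "compactification_le X = (\<lambda>(l1, \<delta>1) (l2, \<delta>2).
     \<exists>L. continuous_map \<delta>2 \<delta>1 L \<and> (\<forall>x\<in>topspace X. L (l2 x) = l1 x))"

definition compactification_equivalent ::
  "'x topology \<Rightarrow> ('x \<Rightarrow> 'a) \<times> 'a topology \<Rightarrow> ('x \<Rightarrow> 'b) \<times> 'b topology \<Rightarrow> bool" where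
  "compactification_equivalent X c d \<longleftrightarrow>
     compactification_le X c d \<and> compactification_le X d c"

(* The T2 compactifications of X over all types do not form a set, so points are taken from the
   type 'x set set. This loses nothing: by T2_compactification_representative below, every T2
   compactification of X, with points of any type, is equivalent to one of these. *)
definition T2_compactifications ::
  "'x topology \<Rightarrow> (('x \<Rightarrow> 'x set set) \<times> 'x set set topology) set" where
  "T2_compactifications X = {c. T2_compactification X c}"

definition compactification_equivalence ::
  "'x topology \<Rightarrow> ((('x \<Rightarrow> 'x set set) \<times> 'x set set topology) \<times>
                  (('x \<Rightarrow> 'x set set) \<times> 'x set set topology)) set" where
  "compactification_equivalence X =
     {(c, d). c \<in> T2_compactifications X \<and> d \<in> T2_compactifications X \<and>
              compactification_equivalent X c d}"

lemma compactification_le_refl: "compactification_le X c c"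
  by (cases c) (auto simp: compactification_le_def intro!: exI[of _ "\<lambda>x. x"])

lemma compactification_le_trans:
  assumes "compactification_le X c d" "compactification_le X d e"
  shows "compactification_le X c e"
proof -
  obtain l1 D1 l2 D2 l3 D3 where eq: "c = (l1, D1)" "d = (l2, D2)" "e = (l3, D3)"
    by (cases c, cases d, cases e) blast
  obtain L where L: "continuous_map D2 D1 L" "\<forall>x\<in>topspace X. L (l2 x) = l1 x"
    using assms(1) by (auto simp: eq compactification_le_def)
  obtain M where M: "continuous_map D3 D2 M" "\<forall>x\<in>topspace X. M (l3 x) = l2 x"
    using assms(2) by (auto simp: eq compactification_le_def)
  have "continuous_map D3 D1 (L \<circ> M)" "\<forall>x\<in>topspace X. (L \<circ> M) (l3 x) = l1 x"
    using L M by (auto intro: continuous_map_compose)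
  then show ?thesis
    unfolding eq compactification_le_def by blast
qed

lemma equiv_compactification_equivalence:
  "equiv (T2_compactifications X) (compactification_equivalence X)"
  unfolding equiv_def refl_on_def sym_def trans_def compactification_equivalence_def
    compactification_equivalent_def
  by (auto intro: compactification_le_refl compactification_le_trans)

(* A point p of the compactification is coded by the traces on X of its open neighbourhoods. *)
lemma T2_compactification_representative:
  fixes X :: "'x topology" and c :: "('x \<Rightarrow> 'a) \<times> 'a topology"
  assumes "T2_compactification X c"
  shows "\<exists>d \<in> T2_compactifications X. compactification_equivalent X c d"
proof -
  obtain l D where c: "c = (l, D)" by (cases c)
  have comp: "compact_space D" and haus: "Hausdorff_space D" and emb: "embedding_map X D l"
    and dense: "D closure_of (l ` topspace X) = topspace D"
    using assms by (auto simp: c T2_compactification_def)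
  have lX: "l ` topspace X \<subseteq> topspace D"
    using emb by (metis embedding_map_def homeomorphic_imp_surjective_map inf.cobounded1
        topspace_subtopology)
  define tr where "tr U = {x \<in> topspace X. l x \<in> U}" for U
  define j where "j p = {tr U |U. openin D U \<and> p \<in> U}" for p
  have inj: "inj_on j (topspace D)"
  proof (rule inj_onI, rule ccontr)
    fix p q assume pq: "p \<in> topspace D" "q \<in> topspace D" "j p = j q" "p \<noteq> q"
    then obtain U V where UV: "openin D U" "openin D V" "p \<in> U" "q \<in> V" "disjnt U V"
      using haus unfolding Hausdorff_space_def by metis
    have "tr U \<in> j q" using UV pq(3) by (auto simp: j_def)
    then obtain W where W: "tr U = tr W" "openin D W" "q \<in> W" by (auto simp: j_def)
    have "q \<in> D closure_of (l ` topspace X)" "openin D (V \<inter> W)" "q \<in> V \<inter> W"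
      using dense pq UV W by auto
    then obtain x where "x \<in> topspace X" "l x \<in> V \<inter> W"
      by (auto simp: in_closure_of)
    then have "l x \<in> V" "l x \<in> U" using W(1) by (auto simp: tr_def)
    then show False using UV(5) by (auto simp: disjnt_def)
  qed
  define g where "g = inv_into (topspace D) j"
  define E where "E = pullback_topology (j ` topspace D) g D"
  have gj: "g (j p) = p" if "p \<in> topspace D" for p
    using inj that by (simp add: g_def)
  have topE: "topspace E = j ` topspace D"
    by (auto simp: E_def topspace_pullback_topology gj)
  have contg: "continuous_map E D g"
    using continuous_map_pullback[of D D id "j ` topspace D" g] by (simp add: E_def)
  have contj: "continuous_map D E j"
    unfolding E_def
  proof (rule continuous_map_pullback')
    show "continuous_map D D (g \<circ> j)"
      by (rule continuous_map_eq[of _ _ id]) (auto simp: gj)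
  qed auto
  have "homeomorphic_maps D E j g"
    unfolding homeomorphic_maps_def using contg contj by (auto simp: gj topE)
  then have hom: "homeomorphic_map D E j"
    using homeomorphic_map_maps by blast
  have "compact_space E" "Hausdorff_space E"
    using comp haus hom homeomorphic_compact_space homeomorphic_Hausdorff_space
      homeomorphic_map_imp_homeomorphic_space by blast+
  moreover have "embedding_map X E (j \<circ> l)"
  proof (rule embedding_map_compose[OF emb])
    show "embedding_map D E j"
      using hom by (simp add: embedding_map_def homeomorphic_imp_surjective_map[OF hom])
  qed
  moreover have "E closure_of ((j \<circ> l) ` topspace X) = topspace E"
    using homeomorphic_map_closure_of[OF hom lX] by (simp add: dense topE image_comp)
  ultimately have "(j \<circ> l, E) \<in> T2_compactifications X"
    by (simp add: T2_compactifications_def T2_compactification_def)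
  moreover have "\<forall>x\<in>topspace X. g ((j \<circ> l) x) = l x"
    using lX by (auto simp: gj)
  then have "compactification_equivalent X c (j \<circ> l, E)"
    unfolding c compactification_equivalent_def compactification_le_def using contg contj by auto
  ultimately show ?thesis by blast
qed

end

(* For 1 < t < 2 let c_t be the closure of the curve x \<mapsto> (arctan x, cos (t x)). Along
   x_n = 2 \<pi> n / t the curve of c_t converges, so c_s \<le> c_t forces cos (2 \<pi> n s / t) to converge.
   But cos (n a) converges only if cos a = 1, so s / t is an integer and hence s = t. *)
theory Submission
  imports Defs
begin

text \<open>Let c be the limit. Passing to the limit in cos ((n + 2) a) + cos (n a) = 2 cos ((n + 1)
  a) cos a gives 2 c = 2 c cos a, so it remains to exclude c = 0.\<close>

lemma convergent_cos_multiples: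
  fixes a :: real
  assumes "convergent (\<lambda>n. cos (real n * a))"
  shows "cos a = 1"
proof -
  obtain c where c: "(\<lambda>n. cos (real n * a)) \<longlonglongrightarrow> c"
    using assms by (auto simp: convergent_def)
  have shift: "(\<lambda>n. cos (real (n + k) * a)) \<longlonglongrightarrow> c" for k
    using c by (rule LIMSEQ_ignore_initial_segment)
  have "cos (real (n + 2) * a) + cos (real n * a) = 2 * cos (real (n + 1) * a) * cos a" for n
  proof -
    have "real (n + 2) * a = real (n + 1) * a + a" "real n * a = real (n + 1) * a - a"
      by (simp_all add: algebra_simps)
    then show ?thesis by (simp only: cos_add cos_diff)
  qed
  moreover have "(\<lambda>n. cos (real (n + 2) * a) + cos (real n * a)) \<longlonglongrightarrow> c + c"
    by (intro tendsto_add shift c)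
  moreover have "(\<lambda>n. 2 * cos (real (n + 1) * a) * cos a) \<longlonglongrightarrow> 2 * c * cos a"
    by (intro tendsto_intros shift)
  ultimately have "c + c = 2 * c * cos a"
    by (metis (no_types, lifting) LIMSEQ_unique ext)
  moreover have "c \<noteq> 0"
  proof
    assume "c = 0"
    \<comment> \<open>The even-indexed terms have the same limit, so the double angle formula makes
      c a root of c = 2 c^2 - 1, and 0 is not one.\<close>
    have "(\<lambda>n. cos (real (2 * n) * a)) \<longlonglongrightarrow> c"
      using LIMSEQ_subseq_LIMSEQ[OF c, of "\<lambda>n. 2 * n"] by (simp add: strict_mono_def o_def)
    moreover have "cos (real (2 * n) * a) = 2 * (cos (real n * a))\<^sup>2 - 1" for n
      using cos_double_cos[of "real n * a"] by (simp add: mult.assoc)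
    moreover have "(\<lambda>n. 2 * (cos (real n * a))\<^sup>2 - 1) \<longlonglongrightarrow> 2 * c\<^sup>2 - 1"
      by (intro tendsto_intros c)
    ultimately have "c = 2 * c\<^sup>2 - 1"
      using LIMSEQ_unique by simp
    with \<open>c = 0\<close> show False by simp
  qed
  ultimately show ?thesis by simp
qed

text \<open>The bounded injective first coordinate makes the curve an embedding with bounded image;
  the second makes it oscillate at a frequency that depends on t.\<close>

definition cos_curve :: "real \<Rightarrow> real \<Rightarrow> real \<times> real" where
  "cos_curve t x = (arctan x, cos (t * x))"

text \<open>For t \<noteq> 0 the closure adds the segments {-pi/2} \<times> [-1, 1] and {pi/2}
  \<times> [-1, 1], whatever t is. So the added points alone cannot tell these compactifications
  apart; the way the line approaches them must.\<close>

definition cos_compactification :: "real \<Rightarrow> (real \<Rightarrow> real \<times> real) \<times> (real \<times> real) topology" where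
  "cos_compactification t = (cos_curve t, top_of_set (closure (range (cos_curve t))))"

lemma continuous_on_cos_curve: "continuous_on S (cos_curve t)"
  unfolding cos_curve_def by (intro continuous_intros)

lemma bounded_range_cos_curve: "bounded (range (cos_curve t))"
proof (rule bounded_subset)
  show "bounded (cball 0 (pi / 2) \<times> cball (0::real) 1)"
    by (intro bounded_Times bounded_cball)
  have "\<bar>arctan x\<bar> \<le> pi / 2" for x
    using arctan_bounded[of x] by linarith
  then show "range (cos_curve t) \<subseteq> cball 0 (pi / 2) \<times> cball 0 1"
    by (auto simp: cos_curve_def)
qed

lemma T2_compactification_cos:
  "T2_compactification (euclidean :: real topology) (cos_compactification t)"
proof -
  let ?l = "cos_curve t" and ?K = "closure (range (cos_curve t))"
  have "compact_space (top_of_set ?K)"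
    using bounded_range_cos_curve
    by (simp add: compact_space_subtopology compactin_euclidean_iff compact_closure)
  moreover have "Hausdorff_space (top_of_set ?K)"
    by (simp add: Hausdorff_space_subtopology)
  moreover have "embedding_map euclidean (top_of_set ?K) ?l"
  proof -
    \<comment> \<open>The inverse of the curve. On the curve the first coordinate is some arctan x,
      whose cosine is nonzero; at first coordinate \<plusminus>pi/2 the cosine vanishes, hence the
      restriction to \<open>range ?l\<close>.\<close>
    have "continuous_on (range ?l) (\<lambda>p. tan (fst p))"
      unfolding tan_def by (intro continuous_intros) (auto simp: cos_curve_def)
    then have "homeomorphic_maps euclidean (top_of_set (range ?l)) ?l (\<lambda>p. tan (fst p))"
      unfolding homeomorphic_maps_def
      by (auto simp: continuous_on_cos_curve continuous_map_in_subtopology tan_arctan)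
        (simp_all add: cos_curve_def tan_arctan)
    then show ?thesis
      by (auto simp: embedding_map_def homeomorphic_map_maps subtopology_subtopology
          Int_absorb1 closure_subset)
  qed
  moreover have "top_of_set ?K closure_of range ?l = ?K"
    by (simp add: closure_of_subtopology Int_absorb1 closure_subset)
  ultimately show ?thesis
    by (simp add: T2_compactification_def cos_compactification_def)
qed

lemma cos_compactification_le_imp_cos_eq_1:
  assumes "t > 0"
    and "compactification_le (euclidean :: real topology)
           (cos_compactification s) (cos_compactification t)"
  shows "cos (s * (2 * pi / t)) = 1"
proof -
  let ?K = "\<lambda>t. closure (range (cos_curve t))"
  obtain L where L: "continuous_on (?K t) L" "\<And>x. L (cos_curve t x) = cos_curve s x"
    using assms(2)
    by (auto simp: compactification_le_def cos_compactification_def continuous_map_in_subtopology)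
  \<comment> \<open>These are the nonnegative points where cos (t x) attains its maximum 1. Since t
    > 0 they tend to infinity, so their images on the curve tend to (pi/2, 1).\<close>
  define x where "x n = real n * (2 * pi / t)" for n
  have "filterlim x at_top sequentially"
    unfolding x_def using assms(1)
    by (intro filterlim_at_top_mult_tendsto_pos[OF tendsto_const _ filterlim_real_sequentially]) simp
  then have "(\<lambda>n. arctan (x n)) \<longlonglongrightarrow> pi / 2"
    by (rule filterlim_compose[OF tendsto_arctan_at_top])
  moreover have "cos (t * x n) = 1" for n
    using cos_2npi[of n] assms(1) by (simp add: x_def field_simps)
  ultimately have lim: "(\<lambda>n. cos_curve t (x n)) \<longlonglongrightarrow> (pi / 2, 1)"
    by (auto simp: cos_curve_def intro: tendsto_Pair)
  have mem: "cos_curve t (x n) \<in> ?K t" for n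
    by (rule subsetD[OF closure_subset]) simp
  have "(pi / 2, 1) \<in> ?K t"
    using closed_sequentially[OF closed_closure mem lim] .
  \<comment> \<open>The limit lies in the compactification, where L is continuous, so L carries the
    convergence over to the curve of s.\<close>
  then have "(\<lambda>n. L (cos_curve t (x n))) \<longlonglongrightarrow> L (pi / 2, 1)"
    by (rule continuous_on_tendsto_compose[OF L(1) lim]) (simp add: mem)
  then have "(\<lambda>n. snd (cos_curve s (x n))) \<longlonglongrightarrow> snd (L (pi / 2, 1))"
    unfolding L(2) by (rule tendsto_snd)
  then have "convergent (\<lambda>n. cos (real n * (s * (2 * pi / t))))"
    by (auto simp: cos_curve_def x_def convergent_def mult_ac)
  then show ?thesis
    by (rule convergent_cos_multiples)
qed

text \<open>The interval is chosen so that s / t lies strictly between 1/2 and 2, where 1 is the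
  only integer.\<close>

lemma cos_compactification_le_imp_eq:
  assumes "s \<in> {1<..<2}" "t \<in> {1<..<2}"
    and "compactification_le (euclidean :: real topology)
           (cos_compactification s) (cos_compactification t)"
  shows "s = t"
proof -
  have "cos (s * (2 * pi / t)) = 1"
    using assms by (intro cos_compactification_le_imp_cos_eq_1) auto
  then obtain k :: int where "s * (2 * pi / t) = real_of_int k * 2 * pi"
    by (auto simp: cos_one_2pi_int)
  then have k: "s = of_int k * t"
    using assms(2) by (simp add: field_simps)
  have "0 < k"
    using k assms(1,2) zero_less_mult_pos2[of "of_int k" t] by simp
  moreover have "k < 2"
  proof (rule ccontr)
    assume "\<not> k < 2"
    \<comment> \<open>Otherwise s = k t \<ge> 2 t > 2.\<close>
    then have "2 * t \<le> of_int k * t"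
      using assms(2) by (intro mult_right_mono) auto
    with k assms(1,2) show False by simp
  qed
  ultimately have "k = 1" by simp
  with k show ?thesis by simp
qed

theorem theorem4p5:
  shows "uncountable (T2_compactifications (euclidean :: real topology) //
                      compactification_equivalence (euclidean :: real topology))"
proof
  let ?X = "euclidean :: real topology"
  let ?R = "compactification_equivalence ?X"
  assume countable: "countable (T2_compactifications ?X // ?R)"
  \<comment> \<open>The curves live in the plane, but the quotient is formed over points of type
    \<open>real set set\<close>; so each is replaced by an equivalent representative
    \<open>d t\<close>.\<close>
  have "\<forall>t. \<exists>d \<in> T2_compactifications ?X.
              compactification_equivalent ?X (cos_compactification t) d"
    using T2_compactification_representative[OF T2_compactification_cos] by blast
  then obtain d where d: "\<And>t. d t \<in> T2_compactifications ?X"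
      "\<And>t. compactification_equivalent ?X (cos_compactification t) (d t)"
    by metis
  have "inj_on (\<lambda>t. ?R `` {d t}) {1<..<2}"
  proof (rule inj_onI)
    fix s t :: real assume st: "s \<in> {1<..<2}" "t \<in> {1<..<2}" "?R `` {d s} = ?R `` {d t}"
    have "(d s, d t) \<in> ?R"
      using eq_equiv_class[OF st(3) equiv_compactification_equivalence] d(1) by blast
    then have "compactification_le ?X (d s) (d t)"
      by (simp add: compactification_equivalence_def compactification_equivalent_def)
    \<comment> \<open>Transitivity along \<open>cos_compactification s\<close>, \<open>d s\<close>,
      \<open>d t\<close>, \<open>cos_compactification t\<close> returns to the plane.\<close>
    then have "compactification_le ?X (cos_compactification s) (cos_compactification t)"
      using d(2) by (metis compactification_equivalent_def compactification_le_trans)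
    then show "s = t"
      using st by (intro cos_compactification_le_imp_eq)
  qed
  moreover have "(\<lambda>t. ?R `` {d t}) ` {1<..<2} \<subseteq> T2_compactifications ?X // ?R"
    using d(1) by (auto intro: quotientI)
  ultimately have "countable {1<..<2::real}"
    using countable countable_subset countable_image_inj_on by blast
  then show False
    using uncountable_open_interval[of 1 "2::real"] by simp
qed

end
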